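(* Let $\mathcal{A}$ be a quantum algorithm that makes $t$ queries to a Boolean input $x\in\{-1,1\}^N$. Then there exists a degree-$2t$ block-multilinear polynomial $p:\mathbb{R}^{2tN}\to\mathbb{R}$, with $2t$ blocks of $N$ variables each, such that (i) the probability that $\mathcal{A}$ accepts $x$ equals $p(x,\ldots,x)$ (with $x$ repeated $2t$ times), for every $x\in\{-1,1\}^N$, and (ii) $p(z)\in[-1,1]$ for all $z\in\{-1,1\}^{2tN}$.
   Context: Quantum query model: the algorithm works on basis states $|i,w\rangle$ with $i\in[N]$ and $w$ a workspace register; each query applies the diagonal unitary $|i,w\rangle\mapsto x_i|i,w\rangle$; between queries arbitrary unitaries independent of $x$ are applied; at the end the state is measured in the computational basis and the algorithm accepts if the outcome lies in a fixed set of accepting basis states. A degree-$m$ polynomial is block-multilinear, with respect to a partition of its variables into $m$ blocks, if every monomial contains exactly one variable from each block. *)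

theory Defs
  imports "HOL-Analysis.Analysis" "HOL-Library.Poly_Mapping"
begin

section \<open>Quantum query algorithms\<close>

definition adjoint_matrix :: "complex^'n^'m \<Rightarrow> complex^'m^'n" where
  "adjoint_matrix A = (\<chi> i j. cnj (A $ j $ i))"

definition unitary_matrix :: "complex^'n^'n \<Rightarrow> bool" where
  "unitary_matrix A \<longleftrightarrow>
     adjoint_matrix A ** A = mat 1 \<and> A ** adjoint_matrix A = mat 1"

text \<open>
  The type \<open>'n\<close> plays the role of the index set \<open>[N]\<close>, so \<open>N = CARD('n)\<close>, and \<open>'w\<close> is the
  set of basis states of the workspace register, of arbitrary finite size.  The unitary
  \<open>unitaries A k\<close> is applied after the \<open>k\<close>-th query; \<open>unitaries A 0\<close> precedes all queries, and
  the entries beyond \<open>num_queries A\<close> are never used.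
\<close>

record ('n, 'w) query_algorithm =
  num_queries :: nat
  init_state :: "complex^('n::finite \<times> 'w::finite)"
  unitaries :: "nat \<Rightarrow> complex^('n \<times> 'w)^('n \<times> 'w)"
  accepting :: "('n \<times> 'w) set"

definition quantum_query_algorithm :: "('n::finite, 'w::finite) query_algorithm \<Rightarrow> bool" where
  "quantum_query_algorithm A \<longleftrightarrow>
     norm (init_state A) = 1 \<and> (\<forall>k\<le>num_queries A. unitary_matrix (unitaries A k))"

definition query_matrix :: "real^'n \<Rightarrow> complex^('n \<times> 'w::finite)^('n \<times> 'w)" where
  "query_matrix x = (\<chi> b c. if b = c then complex_of_real (x $ fst b) else 0)"

primrec state_after ::
    "('n::finite, 'w::finite) query_algorithm \<Rightarrow> real^'n \<Rightarrow> nat \<Rightarrow> complex^('n \<times> 'w)" where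
  "state_after A x 0 = unitaries A 0 *v init_state A"
| "state_after A x (Suc k) = unitaries A (Suc k) *v (query_matrix x *v state_after A x k)"

definition acceptance_probability ::
    "('n::finite, 'w::finite) query_algorithm \<Rightarrow> real^'n \<Rightarrow> real" where
  "acceptance_probability A x =
     (\<Sum>b\<in>accepting A. (cmod (state_after A x (num_queries A) $ b))\<^sup>2)"


section \<open>Block-multilinear polynomials\<close>

text \<open>
  A real polynomial in variables indexed by \<open>'v\<close> is a finitely supported map from monomials
  to coefficients, a monomial being a finitely supported map from variables to exponents.
\<close>

type_synonym 'v monomial = "'v \<Rightarrow>\<^sub>0 nat"
type_synonym 'v real_mpoly = "'v monomial \<Rightarrow>\<^sub>0 real"

definition monomial_degree :: "'v monomial \<Rightarrow> nat" where
  "monomial_degree \<mu> = (\<Sum>v\<in>Poly_Mapping.keys \<mu>. Poly_Mapping.lookup \<mu> v)"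

definition eval_mpoly :: "'v real_mpoly \<Rightarrow> ('v \<Rightarrow> real) \<Rightarrow> real" where
  "eval_mpoly p z =
     (\<Sum>\<mu>\<in>Poly_Mapping.keys p. Poly_Mapping.lookup p \<mu> *
        (\<Prod>v\<in>Poly_Mapping.keys \<mu>. z v ^ Poly_Mapping.lookup \<mu> v))"

text \<open>
  Variable \<open>(j, i)\<close> is the \<open>i\<close>-th variable of block \<open>j\<close>, and the blocks are numbered
  \<open>0, \<dots>, m - 1\<close>.  Since each monomial has degree \<open>m\<close> and meets each of the \<open>m\<close> blocks in one
  variable, all exponents are at most 1.  The zero polynomial is included: it is the only
  candidate, for example, when \<open>N = 1\<close> and the algorithm never accepts.
\<close>

definition block_multilinear :: "nat \<Rightarrow> (nat \<times> 'n) real_mpoly \<Rightarrow> bool" where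
  "block_multilinear m p \<longleftrightarrow>
     (\<forall>\<mu>\<in>Poly_Mapping.keys p. Poly_Mapping.keys \<mu> \<subseteq> {..<m} \<times> UNIV \<and>
        monomial_degree \<mu> = m \<and> (\<forall>j<m. \<exists>!i. (j, i) \<in> Poly_Mapping.keys \<mu>))"

end

theory Submission
  imports Defs
begin

text \<open>
  Feeding a fresh block of variables to every query makes the amplitudes of the final state
  block-multilinear in \<open>t\<close> blocks, and the final state remains a unit vector when all variables
  are \<open>\<plusminus>1\<close>.  The polynomial is the real part of the inner product of two such states, built from
  disjoint sets of \<open>t\<close> blocks and projected to the accepting basis states: on the diagonal this
  is the acceptance probability, and by Cauchy-Schwarz it lies in \<open>[-1, 1]\<close>.
\<close>

section \<open>Block-multilinear forms\<close>

text \<open>The coefficients are complex because amplitudes are. A monomial is encoded by the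
  function \<open>g\<close> that picks its variable in each block; extensionality of
  \<open>g\<close> makes the index unique.\<close>

definition block_multilinear_form :: "nat \<Rightarrow> ((nat \<times> 'n::finite \<Rightarrow> real) \<Rightarrow> complex) \<Rightarrow> bool" where
  "block_multilinear_form m f \<longleftrightarrow>
     (\<exists>c. \<forall>z. f z = (\<Sum>g\<in>{..<m} \<rightarrow>\<^sub>E UNIV. c g * of_real (\<Prod>j<m. z (j, g j))))"

lemma block_multilinear_form_const: "block_multilinear_form 0 (\<lambda>z. a)"
  unfolding block_multilinear_form_def by (rule exI[of _ "\<lambda>g. a"]) simp

lemma block_multilinear_form_scale:
  assumes "block_multilinear_form m f"
  shows "block_multilinear_form m (\<lambda>z. a * f z)"
proof -
  obtain c where "\<And>z. f z = (\<Sum>g\<in>{..<m} \<rightarrow>\<^sub>E UNIV. c g * of_real (\<Prod>j<m. z (j, g j)))"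
    using assms unfolding block_multilinear_form_def by blast
  then show ?thesis
    unfolding block_multilinear_form_def
    by (intro exI[of _ "\<lambda>g. a * c g"]) (simp add: sum_distrib_left mult.assoc)
qed

lemma block_multilinear_form_sum:
  assumes "\<And>b. b \<in> B \<Longrightarrow> block_multilinear_form m (f b)"
  shows "block_multilinear_form m (\<lambda>z. \<Sum>b\<in>B. f b z)"
proof -
  obtain c where "\<And>b z. b \<in> B \<Longrightarrow>
      f b z = (\<Sum>g\<in>{..<m} \<rightarrow>\<^sub>E UNIV. c b g * of_real (\<Prod>j<m. z (j, g j)))"
    using assms unfolding block_multilinear_form_def by metis
  then have "(\<Sum>b\<in>B. f b z) =
      (\<Sum>g\<in>{..<m} \<rightarrow>\<^sub>E UNIV. (\<Sum>b\<in>B. c b g) * of_real (\<Prod>j<m. z (j, g j)))" for z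
    unfolding sum_distrib_right by (subst sum.swap) (simp cong: sum.cong)
  then show ?thesis
    unfolding block_multilinear_form_def by (intro exI[of _ "\<lambda>g. \<Sum>b\<in>B. c b g"]) simp
qed

lemma block_multilinear_form_cnj:
  assumes "block_multilinear_form m f"
  shows "block_multilinear_form m (\<lambda>z. cnj (f z))"
proof -
  obtain c where "\<And>z. f z = (\<Sum>g\<in>{..<m} \<rightarrow>\<^sub>E UNIV. c g * of_real (\<Prod>j<m. z (j, g j)))"
    using assms unfolding block_multilinear_form_def by blast
  then show ?thesis
    unfolding block_multilinear_form_def
    by (intro exI[of _ "\<lambda>g. cnj (c g)"]) simp
qed

lemma block_multilinear_form_mult_variable:
  fixes f :: "(nat \<times> 'n::finite \<Rightarrow> real) \<Rightarrow> complex"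
  assumes "block_multilinear_form m f"
  shows "block_multilinear_form (Suc m) (\<lambda>z. of_real (z (m, i)) * f z)"
proof -
  obtain c where c: "\<And>z. f z = (\<Sum>g\<in>{..<m} \<rightarrow>\<^sub>E UNIV. c g * of_real (\<Prod>j<m. z (j, g j)))"
    using assms unfolding block_multilinear_form_def by blast
  \<comment> \<open>Choices of another variable in block \<open>m\<close> get coefficient 0;
    \<open>restrict\<close> recovers the index of the original coefficient.\<close>
  define c' where "c' g = (if g m = i then c (restrict g {..<m}) else 0)" for g :: "nat \<Rightarrow> 'n"
  have "of_real (z (m, i)) * f z =
      (\<Sum>g\<in>{..<Suc m} \<rightarrow>\<^sub>E UNIV. c' g * of_real (\<Prod>j<Suc m. z (j, g j)))" for z
  proof -
    have "(\<Sum>g\<in>{..<Suc m} \<rightarrow>\<^sub>E UNIV. c' g * of_real (\<Prod>j<Suc m. z (j, g j))) =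
        (\<Sum>g\<in>{g \<in> {..<Suc m} \<rightarrow>\<^sub>E UNIV. g m = i}. c' g * of_real (\<Prod>j<Suc m. z (j, g j)))"
      by (rule sum.mono_neutral_right) (auto simp: c'_def finite_PiE)
    also have "\<dots> = (\<Sum>g\<in>{..<m} \<rightarrow>\<^sub>E UNIV.
        of_real (z (m, i)) * (c g * of_real (\<Prod>j<m. z (j, g j))))"
    proof (rule sum.reindex_bij_witness[of _ "\<lambda>g. g(m := i)" "\<lambda>g. restrict g {..<m}"])
      fix g :: "nat \<Rightarrow> 'n" assume "g \<in> {g \<in> {..<Suc m} \<rightarrow>\<^sub>E UNIV. g m = i}"
      then show "(restrict g {..<m})(m := i) = g"
        by (auto simp: fun_eq_iff PiE_iff extensional_def)
    next
      fix g :: "nat \<Rightarrow> 'n" assume "g \<in> {..<m} \<rightarrow>\<^sub>E UNIV"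
      then show "restrict (g(m := i)) {..<m} = g"
        by (auto simp: fun_eq_iff PiE_iff extensional_def)
    next
      fix g :: "nat \<Rightarrow> 'n" assume "g \<in> {..<m} \<rightarrow>\<^sub>E UNIV"
      then show "g(m := i) \<in> {g \<in> {..<Suc m} \<rightarrow>\<^sub>E UNIV. g m = i}"
        by (auto simp: PiE_iff extensional_def)
    next
      fix g :: "nat \<Rightarrow> 'n" assume "g \<in> {g \<in> {..<Suc m} \<rightarrow>\<^sub>E UNIV. g m = i}"
      then show "of_real (z (m, i)) * (c (restrict g {..<m}) *
            of_real (\<Prod>j<m. z (j, restrict g {..<m} j))) =
          c' g * of_real (\<Prod>j<Suc m. z (j, g j))"
        by (simp add: c'_def)
    qed auto
    finally show ?thesis by (simp add: c sum_distrib_left)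
  qed
  then show ?thesis unfolding block_multilinear_form_def by blast
qed

section \<open>From forms to formal polynomials\<close>

lemma lookup_sum_single_graph:
  fixes m :: nat
  shows "Poly_Mapping.lookup (\<Sum>j<m. Poly_Mapping.single (j, g j) (1::nat)) v =
     (if fst v < m \<and> snd v = g (fst v) then 1 else 0)"
proof -
  have "Poly_Mapping.lookup (\<Sum>j<m. Poly_Mapping.single (j, g j) (1::nat)) v =
      (\<Sum>j<m. if j = fst v then (if snd v = g (fst v) then 1 else 0) else 0)"
    unfolding lookup_sum lookup_single
    by (rule sum.cong) (auto simp: when_def prod_eq_iff)
  then show ?thesis by simp
qed

text \<open>Distinct choice functions give distinct monomials, so the coefficients can be read off
  one by one. Monomials are real at real points, hence taking real parts of the coefficients takes
  the real part of \<open>f\<close>.\<close>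

lemma block_multilinear_form_imp_mpoly:
  fixes f :: "(nat \<times> 'n::finite \<Rightarrow> real) \<Rightarrow> complex"
  assumes "block_multilinear_form m f"
  shows "\<exists>p. block_multilinear m p \<and> (\<forall>z. eval_mpoly p z = Re (f z))"
proof -
  obtain c where c: "\<And>z. f z = (\<Sum>g\<in>{..<m} \<rightarrow>\<^sub>E UNIV. c g * of_real (\<Prod>j<m. z (j, g j)))"
    using assms unfolding block_multilinear_form_def by blast
  define P where "P = ({..<m} \<rightarrow>\<^sub>E UNIV :: (nat \<Rightarrow> 'n) set)"
  have finP: "finite P" by (simp add: P_def finite_PiE)
  define mono where "mono g = (\<Sum>j<m. Poly_Mapping.single (j, g j) (1::nat))" for g :: "nat \<Rightarrow> 'n"
  define p where "p = (\<Sum>g\<in>P. Poly_Mapping.single (mono g) (Re (c g)))"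
  have lookup_mono: "Poly_Mapping.lookup (mono g) v =
      (if fst v < m \<and> snd v = g (fst v) then 1 else 0)" for g v
    unfolding mono_def by (rule lookup_sum_single_graph)
  have keys_mono: "Poly_Mapping.keys (mono g) = (\<lambda>j. (j, g j)) ` {..<m}" for g
    by (auto simp: in_keys_iff lookup_mono image_iff split: if_splits)
  have inj_graph: "inj_on (\<lambda>j. (j, g j)) {..<m}" for g :: "nat \<Rightarrow> 'n"
    by (auto intro: inj_onI)
  \<comment> \<open>The keys of \<open>mono g\<close> form the graph of \<open>g\<close> on
    \<open>{..<m}\<close>, and extensionality fixes \<open>g\<close> elsewhere.\<close>
  have inj: "inj_on mono P"
  proof (rule inj_onI)
    fix g h assume gh: "g \<in> P" "h \<in> P" "mono g = mono h"
    show "g = h"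
    proof (rule PiE_ext[of g "{..<m}" "\<lambda>_. UNIV" h])
      fix j assume "j \<in> {..<m}"
      then have "(j, g j) \<in> Poly_Mapping.keys (mono g)" by (simp add: keys_mono)
      then show "g j = h j" by (auto simp: gh keys_mono)
    qed (use gh in \<open>simp_all add: P_def\<close>)
  qed
  have lookup_p: "Poly_Mapping.lookup p (mono g) = Re (c g)" if "g \<in> P" for g
  proof -
    have "Poly_Mapping.lookup p (mono g) = (\<Sum>h\<in>P. if h = g then Re (c h) else 0)"
      unfolding p_def lookup_sum
      by (rule sum.cong) (use that inj in \<open>auto simp: lookup_single when_def inj_on_def\<close>)
    then show ?thesis using that finP by simp
  qed
  \<comment> \<open>Only an inclusion: monomials with \<open>Re (c g) = 0\<close> drop out of the
    support. The evaluation below adds them back as zero terms.\<close>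
  have keys_p: "Poly_Mapping.keys p \<subseteq> mono ` P"
  proof
    fix \<mu> assume "\<mu> \<in> Poly_Mapping.keys p"
    then have "(\<Sum>h\<in>P. Re (c h) when mono h = \<mu>) \<noteq> 0"
      by (simp add: in_keys_iff p_def lookup_sum lookup_single)
    then obtain h where "h \<in> P" "(Re (c h) when mono h = \<mu>) \<noteq> 0"
      by (rule sum.not_neutral_contains_not_neutral)
    then show "\<mu> \<in> mono ` P" by (auto simp: when_def split: if_splits)
  qed
  have "block_multilinear m p"
    unfolding block_multilinear_def
  proof
    fix \<mu> assume "\<mu> \<in> Poly_Mapping.keys p"
    then obtain g where g: "\<mu> = mono g" using keys_p by auto
    have "monomial_degree (mono g) = m"
      unfolding monomial_degree_def keys_mono sum.reindex[OF inj_graph]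
      by (simp add: lookup_mono)
    then show "Poly_Mapping.keys \<mu> \<subseteq> {..<m} \<times> UNIV \<and> monomial_degree \<mu> = m \<and>
        (\<forall>j<m. \<exists>!i. (j, i) \<in> Poly_Mapping.keys \<mu>)"
      by (auto simp: g keys_mono)
  qed
  moreover have "eval_mpoly p z = Re (f z)" for z
  proof -
    have "eval_mpoly p z = (\<Sum>\<mu>\<in>mono ` P. Poly_Mapping.lookup p \<mu> *
        (\<Prod>v\<in>Poly_Mapping.keys \<mu>. z v ^ Poly_Mapping.lookup \<mu> v))"
      unfolding eval_mpoly_def
      by (rule sum.mono_neutral_left) (use keys_p finP in \<open>auto simp: in_keys_iff\<close>)
    also have "\<dots> = (\<Sum>g\<in>P. Re (c g) * (\<Prod>j<m. z (j, g j)))"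
      unfolding sum.reindex[OF inj] keys_mono
      by (rule sum.cong) (simp_all add: lookup_p keys_mono prod.reindex[OF inj_graph] lookup_mono)
    also have "\<dots> = Re (f z)" by (simp add: c P_def del: of_real_prod)
    finally show ?thesis .
  qed
  ultimately show ?thesis by blast
qed

section \<open>Queries to distinct blocks of variables\<close>

text \<open>The offset \<open>m\<close> is the first block read: \<open>k\<close> queries read
  blocks \<open>m\<close> to \<open>m + k - 1\<close>, so offsets 0 and \<open>t\<close> give two
  runs of \<open>t\<close> queries on disjoint blocks.\<close>

primrec blocked_state ::
    "('n::finite, 'w::finite) query_algorithm \<Rightarrow> nat \<Rightarrow> (nat \<times> 'n \<Rightarrow> real) \<Rightarrow> nat \<Rightarrow>
       complex^('n \<times> 'w)" where
  "blocked_state A m z 0 = unitaries A 0 *v init_state A"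
| "blocked_state A m z (Suc k) =
     unitaries A (Suc k) *v (query_matrix (\<chi> i. z (m + k, i)) *v blocked_state A m z k)"

lemma query_matrix_mult_nth:
  "(query_matrix x *v v) $ b = complex_of_real (x $ fst b) * v $ b"
proof -
  have "(query_matrix x *v v) $ b =
      (\<Sum>c\<in>UNIV. if c = b then complex_of_real (x $ fst b) * v $ b else 0)"
    unfolding query_matrix_def matrix_vector_mult_def vec_lambda_beta by (rule sum.cong) auto
  then show ?thesis by simp
qed

text \<open>Any offset works, since repeating \<open>x\<close> in all blocks makes them
  indistinguishable.\<close>

lemma state_after_eq_blocked_state:
  "state_after A x k = blocked_state A m (\<lambda>(j, i). x $ i) k"
  by (induction k) simp_all

text \<open>Carrying a factor \<open>f\<close> on the first \<open>m\<close> blocks lets one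
  induction serve twice: \<open>f = 1\<close> handles a single amplitude, and a conjugated amplitude
  as \<open>f\<close> handles the product of two runs.\<close>

lemma block_multilinear_form_mult_blocked_state:
  assumes "block_multilinear_form m f"
  shows "block_multilinear_form (m + k) (\<lambda>z. f z * blocked_state A m z k $ b)"
proof (induction k arbitrary: b)
  case 0
  show ?case
    using block_multilinear_form_scale[OF assms, of "(unitaries A 0 *v init_state A) $ b"]
    by (simp add: mult.commute)
next
  case (Suc k)
  \<comment> \<open>Moving \<open>f z\<close> inside the sum exposes the product covered by the
    induction hypothesis, times one variable of the fresh block \<open>m + k\<close>.\<close>
  have "f z * blocked_state A m z (Suc k) $ b =
      (\<Sum>c\<in>UNIV. unitaries A (Suc k) $ b $ c *
        (of_real (z (m + k, fst c)) * (f z * blocked_state A m z k $ c)))" for z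
    by (simp add: matrix_vector_mult_def[of "unitaries A (Suc k)"] query_matrix_mult_nth
        sum_distrib_left mult_ac)
  then show ?case
    using Suc.IH
    by (auto intro!: block_multilinear_form_sum block_multilinear_form_scale
        block_multilinear_form_mult_variable)
qed

section \<open>Norm preservation and Cauchy-Schwarz\<close>

text \<open>Here \<open>\<bullet>\<close> is the real part of the Hermitian inner product, so a
  scalar crosses it as its conjugate.\<close>

lemma inner_matrix_vector_mult:
  "(A *v x) \<bullet> y = x \<bullet> (adjoint_matrix A *v (y :: complex^'m))"
proof -
  have move: "(a * b) \<bullet> c = b \<bullet> (cnj a * c)" for a b c :: complex
    by (simp add: inner_complex_def algebra_simps)
  have "(A *v x) \<bullet> y = (\<Sum>i\<in>UNIV. \<Sum>j\<in>UNIV. x $ j \<bullet> (cnj (A $ i $ j) * y $ i))"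
    by (simp add: inner_vec_def matrix_vector_mult_def inner_sum_left move)
  also have "\<dots> = x \<bullet> (adjoint_matrix A *v y)"
    by (subst sum.swap)
      (simp add: inner_vec_def matrix_vector_mult_def inner_sum_right adjoint_matrix_def)
  finally show ?thesis .
qed

lemma norm_unitary_matrix_mult:
  assumes "unitary_matrix U"
  shows "norm (U *v x) = norm x"
  using assms
  by (simp add: norm_eq_sqrt_inner inner_matrix_vector_mult matrix_vector_mul_assoc
      unitary_matrix_def)

lemma norm_query_matrix_mult:
  assumes "\<And>i. x $ i \<in> {-1, 1}"
  shows "norm (query_matrix x *v v) = norm v"
proof -
  have "\<bar>x $ i\<bar> = 1" for i using assms[of i] by auto
  then show ?thesis by (simp add: norm_vec_def query_matrix_mult_nth norm_mult)
qed

text \<open>The blocks may disagree with each other: each query applies its own diagonal matrix of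
  signs, which preserves the norm.\<close>

lemma norm_blocked_state:
  assumes "quantum_query_algorithm A" "k \<le> num_queries A"
    and "\<And>j i. j < m + k \<Longrightarrow> z (j, i) \<in> {-1, 1}"
  shows "norm (blocked_state A m z k) = 1"
  using assms(2,3)
proof (induction k)
  case 0
  then show ?case
    using assms(1) by (simp add: quantum_query_algorithm_def norm_unitary_matrix_mult)
next
  case (Suc k)
  then have "norm (blocked_state A m z k) = 1" by simp
  moreover have "unitary_matrix (unitaries A (Suc k))"
    using assms(1) Suc.prems(1) by (simp add: quantum_query_algorithm_def)
  moreover have "(\<chi> i. z (m + k, i)) $ i \<in> {-1, 1}" for i
    using Suc.prems(2)[of "m + k" i] by simp
  ultimately show ?case
    by (simp add: norm_unitary_matrix_mult norm_query_matrix_mult del: insert_iff)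
qed

text \<open>Passing to moduli first makes all terms nonnegative, so the sum over \<open>B\<close>
  can be enlarged to all coordinates before Cauchy-Schwarz.\<close>

lemma cmod_sum_cnj_mult_le:
  fixes v w :: "complex^'m"
  shows "cmod (\<Sum>b\<in>B. cnj (v $ b) * w $ b) \<le> norm v * norm w"
proof -
  have "cmod (\<Sum>b\<in>B. cnj (v $ b) * w $ b) \<le> (\<Sum>b\<in>B. \<bar>cmod (v $ b)\<bar> * \<bar>cmod (w $ b)\<bar>)"
    by (rule order_trans[OF norm_sum]) (simp add: norm_mult)
  also have "\<dots> \<le> (\<Sum>b\<in>UNIV. \<bar>cmod (v $ b)\<bar> * \<bar>cmod (w $ b)\<bar>)"
    by (rule sum_mono2) auto
  also have "\<dots> \<le> norm v * norm w"
    unfolding norm_vec_def by (rule L2_set_mult_ineq)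
  finally show ?thesis .
qed

theorem lemma20:
  fixes A :: "('n::finite, 'w::finite) query_algorithm" and t :: nat
  assumes "quantum_query_algorithm A"
    and "num_queries A = t"
  shows "\<exists>p :: (nat \<times> 'n) real_mpoly.
           block_multilinear (2 * t) p \<and>
           (\<forall>x :: real^'n. (\<forall>i. x $ i \<in> {-1, 1}) \<longrightarrow>
              acceptance_probability A x = eval_mpoly p (\<lambda>(j, i). x $ i)) \<and>
           (\<forall>z. (\<forall>j<2 * t. \<forall>i. z (j, i) \<in> {-1, 1}) \<longrightarrow> eval_mpoly p z \<in> {-1..1})"
proof -
  \<comment> \<open>The conjugated run reads blocks 0 to \<open>t - 1\<close>, the other one blocks
    \<open>t\<close> to \<open>2 * t - 1\<close>.\<close>
  define f where "f z = (\<Sum>b\<in>accepting A.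
      cnj (blocked_state A 0 z t $ b) * blocked_state A t z t $ b)" for z
  have "block_multilinear_form t (\<lambda>z. blocked_state A 0 z t $ b)" for b
    using block_multilinear_form_mult_blocked_state[OF block_multilinear_form_const[of 1],
        of t A b] by simp
  then have "block_multilinear_form (t + t) f"
    unfolding f_def
    by (intro block_multilinear_form_sum block_multilinear_form_mult_blocked_state
        block_multilinear_form_cnj)
  then obtain p where p: "block_multilinear (2 * t) p" "\<And>z. eval_mpoly p z = Re (f z)"
    using block_multilinear_form_imp_mpoly[of "t + t" f] by (auto simp: mult_2)
  have "acceptance_probability A x = eval_mpoly p (\<lambda>(j, i). x $ i)" for x
  proof -
    \<comment> \<open>On the diagonal both runs end in the same state, so each term is a squared
      modulus and \<open>f\<close> is real.\<close>
    have "f (\<lambda>(j, i). x $ i) = (\<Sum>b\<in>accepting A. of_real ((cmod (state_after A x t $ b))\<^sup>2))"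
      unfolding f_def state_after_eq_blocked_state[symmetric]
      by (rule sum.cong) (simp_all only: complex_norm_square mult.commute)
    then show ?thesis
      using assms(2) by (simp add: p(2) acceptance_probability_def del: of_real_power)
  qed
  moreover have "eval_mpoly p z \<in> {-1..1}" if "\<forall>j<2 * t. \<forall>i. z (j, i) \<in> {-1, 1}" for z
  proof -
    \<comment> \<open>With \<open>m \<le> t\<close> all blocks read lie below \<open>2 * t\<close>,
      where \<open>z\<close> is known to take signs; this is applied to the offsets 0 and
      \<open>t\<close>.\<close>
    have "norm (blocked_state A m z t) = 1" if "m \<le> t" for m
      using assms \<open>m \<le> t\<close> \<open>\<forall>j<2 * t. \<forall>i. z (j, i) \<in> {-1, 1}\<close>
      by (intro norm_blocked_state) auto
    then have "cmod (f z) \<le> 1"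
      using cmod_sum_cnj_mult_le[of "blocked_state A 0 z t" "blocked_state A t z t" "accepting A"]
      by (simp add: f_def)
    then have "\<bar>Re (f z)\<bar> \<le> 1" using abs_Re_le_cmod[of "f z"] by linarith
    then show ?thesis by (simp add: p(2) abs_le_iff)
  qed
  ultimately show ?thesis using p(1) by blast
qed

end
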